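(* Let $\Bbbk$ be a field and $0\ne v\in\Bbbk$ with $[n]!\ne0$ in $\Bbbk$. Given any $1$-factor $\alpha$ of length at most $n$, let $m=m(\alpha)$ be the maximum element of its weight sequence. Then $$\mu(\alpha)=\sum_{\beta\le\alpha}\pi'_{\alpha,\beta}\,\eta(\beta)$$ for some $\pi'_{\alpha,\beta}\in\Bbbk$, where the sum is over $1$-factors $\beta$ of the same shape as $\alpha$ with $\beta\le\alpha$, and $\pi'_{\alpha,\alpha}\neq0$. Furthermore, there are polynomials $\pi''_{\alpha,\beta}(t_1,\dots,t_m)$ in $m$ commuting indeterminates $t_1,\dots,t_m$ with nonnegative integer coefficients such that $\pi'_{\alpha,\beta}=\pi''_{\alpha,\beta}([1],[2],\dots,[m])$.
   Context: Quantum integers: for $k\ge0$, $[k]=\sum_{t=0}^{k-1}v^{k-1-2t}\in\Bbbk$, $[-k]=-[k]$, $[k]!=[1][2]\cdots[k]$, $[0]!=1$. $V$ is the two-dimensional space with basis $y_1,y_{-1}$ and operators $Fy_1=y_{-1}$, $Fy_{-1}=0$, $Ky_{\pm1}=v^{\pm1}y_{\pm1}$. On $V^{\otimes m}$, $F$ acts as $\sum_{j=1}^m1^{\otimes(j-1)}\otimes F\otimes(K^{-1})^{\otimes(m-j)}$; $y_{i_1}\otimes\cdots\otimes y_{i_m}$ ($i_j\in\{\pm1\}$) has weight $\sum_ji_j$. ($V^{\otimes0}=\Bbbk$, of weight $0$, with $F=0$.) For $b\in V^{\otimes(m-1)}$ of weight $i_b$, $\Phi_1(b)=b\otimes y_1$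 and $\Phi_2(b)=[i_b]\,b\otimes y_{-1}-v^{i_b}Fb\otimes y_1$. A $1$-factor of length $l$ is a sequence $\alpha=(\alpha_1,\dots,\alpha_l)$ with $\alpha_i=\pm1$ and all partial sums $\alpha_1+\cdots+\alpha_i\ge0$. The sequence of partial sums is the weight sequence of $\alpha$. If $\alpha_i=1$ and $j$ is the smallest index with $i<j\le l$ and $\alpha_i+\cdots+\alpha_j=0$, then $(i,j)$ is a pairing of $\alpha$; unpaired indices are called defects. The shape of $\alpha$ is the partition $(l-p,p)$, where $p$ is the number of entries equal to $-1$. For $1$-factors of equal length, $\beta\le\alpha$ means $\beta_1+\cdots+\beta_j\le\alpha_1+\cdots+\alpha_j$ for every $j$. $\mu(\alpha)=\Upsilon_l\cdots\Upsilon_1(1)\in V^{\otimes l}$, where $\Upsilon_i=\Phi_1$ if $\alpha_i=1$ and $\Upsilon_i=\Phi_2$ if $\alpha_i=-1$. $\eta(\alpha)\in V^{\otimes l}$ is the tensor product, in order, of a factor $y_1$ for each defect and of nested links; explicitly: $\eta(\emptyset)=1$; if index $1$ is a defect, $\eta(\alpha)=y_1\otimes\eta(\alpha_2,\dots,\alpha_l)$; if $1$ is paired with $j$, $\eta(\alpha)=\Psi(\eta(\alpha_2,\dots,\alpha_{j-1}))\otimes\eta(\alpha_{j+1},\dots,\alpha_l)$, where $\Psi(b)=y_1\otimes b\otimes y_{-1}-v\,y_{-1}\otimes b\otimes y_1$. *)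

theory Defs
  imports Complex_Main "HOL-Library.Poly_Mapping"
begin

definition qint :: "'a::field \<Rightarrow> int \<Rightarrow> 'a" where
  "qint v k = (if 0 \<le> k then \<Sum>t<nat k. v powi (k - 1 - 2 * int t)
               else - (\<Sum>t<nat (- k). v powi (- k - 1 - 2 * int t)))"

definition qfact :: "'a::field \<Rightarrow> nat \<Rightarrow> 'a" where
  "qfact v n = (\<Prod>k=1..n. qint v (int k))"

text \<open>The direct sum of all tensor powers of V is the tensor algebra of V, i.e. the monoid
  algebra of the free monoid on the basis of V.  With lists as a monoid under concatenation, this
  is the ring of finitely supported functions on words with the convolution product; so
  multiplication is the tensor product, and the unit is the element 1 of the zeroth tensor
  power.\<close>

instantiation list :: (type) monoid_add
begin
definition zero_list :: "'a list" where "zero_list = []"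
definition plus_list :: "'a list \<Rightarrow> 'a list \<Rightarrow> 'a list" where "plus_list xs ys = xs @ ys"
instance by standard (simp_all add: zero_list_def plus_list_def)
end

text \<open>\<open>Yp\<close> and \<open>Ym\<close> index the basis vectors y_1 and y_{-1} of V.\<close>

datatype idx = Yp | Ym

fun idx_val :: "idx \<Rightarrow> int" where
  "idx_val Yp = 1"
| "idx_val Ym = -1"

definition weight :: "idx list \<Rightarrow> int" where
  "weight w = sum_list (map idx_val w)"

type_synonym 'a tensor = "idx list \<Rightarrow>\<^sub>0 'a"

abbreviation word :: "idx list \<Rightarrow> 'a::field tensor" where
  "word w \<equiv> Poly_Mapping.single w 1"

abbreviation yv :: "idx \<Rightarrow> 'a::field tensor" where
  "yv i \<equiv> word [i]"

definition scale :: "'a::field \<Rightarrow> 'a tensor \<Rightarrow> 'a tensor" where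
  "scale c x = Poly_Mapping.single [] c * x"

lemma lookup_scale: "Poly_Mapping.lookup (scale c x) w = c * Poly_Mapping.lookup x w"
  unfolding scale_def zero_list_def[symmetric] mult_map_scale_conv_mult[symmetric]
  by (simp add: Poly_Mapping.map.rep_eq when_def)

definition lin_ext :: "(idx list \<Rightarrow> 'a tensor) \<Rightarrow> 'a::field tensor \<Rightarrow> 'a tensor" where
  "lin_ext f x = (\<Sum>w\<in>Poly_Mapping.keys x. scale (Poly_Mapping.lookup x w) (f w))"

fun F_V :: "idx \<Rightarrow> 'a::field tensor" where
  "F_V Yp = yv Ym"
| "F_V Ym = 0"

definition Kinv_V :: "'a::field \<Rightarrow> idx \<Rightarrow> 'a tensor" where
  "Kinv_V v i = scale (v powi (- idx_val i)) (yv i)"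

definition F_op :: "'a::field \<Rightarrow> 'a tensor \<Rightarrow> 'a tensor" where
  "F_op v = lin_ext (\<lambda>w. \<Sum>j<length w.
      word (take j w) * F_V (w ! j) * prod_list (map (Kinv_V v) (drop (Suc j) w)))"

definition Phi1 :: "'a::field tensor \<Rightarrow> 'a tensor" where
  "Phi1 b = b * yv Yp"

text \<open>The formula for the second operator is given on vectors b of a fixed weight; here it is
  extended linearly from the (homogeneous) basis words.  Lemma \<open>Phi2_weight\<close> recovers the formula
  for every homogeneous b.\<close>

definition Phi2 :: "'a::field \<Rightarrow> 'a tensor \<Rightarrow> 'a tensor" where
  "Phi2 v = lin_ext (\<lambda>w.
      scale (qint v (weight w)) (word w * yv Ym) - scale (v powi weight w) (F_op v (word w) * yv Yp))"

lemma scale_diff_right: "scale c (x - x') = scale c x - scale c x'"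
  by (simp add: scale_def right_diff_distrib)

lemma scale_sum_right: "scale c (sum f A) = (\<Sum>a\<in>A. scale c (f a))"
  by (simp add: scale_def sum_distrib_left)

lemma scale_scale: "scale c (scale d x) = scale (c * d) x"
  by (rule poly_mapping_eqI) (simp add: lookup_scale)

lemma scale_mult_left: "scale c x * z = scale c (x * z)"
  by (simp add: scale_def mult.assoc)

lemma lin_ext_word: "lin_ext f (word w) = f w"
  by (rule poly_mapping_eqI) (simp add: lin_ext_def lookup_scale)

lemma tensor_expand: "(\<Sum>w\<in>Poly_Mapping.keys x. scale (Poly_Mapping.lookup x w) (word w)) = x"
  by (rule poly_mapping_eqI)
    (auto simp: lookup_sum lookup_scale lookup_single when_def sum.delta' in_keys_iff
      mult.commute if_distrib cong: if_cong)

lemma Phi2_weight: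
  fixes b :: "'a::field tensor"
  assumes "\<And>w. w \<in> Poly_Mapping.keys b \<Longrightarrow> weight w = i"
  shows "Phi2 v b = scale (qint v i) (b * yv Ym) - scale (v powi i) (F_op v b * yv Yp)"
proof -
  let ?K = "Poly_Mapping.keys b" and ?c = "Poly_Mapping.lookup b"
  have F: "F_op v b = (\<Sum>w\<in>?K. scale (?c w) (F_op v (word w)))"
    unfolding F_op_def lin_ext_word by (simp add: lin_ext_def)
  have "Phi2 v b = (\<Sum>w\<in>?K. scale (qint v i) (scale (?c w) (word w) * yv Ym)
                         - scale (v powi i) (scale (?c w) (F_op v (word w)) * yv Yp))"
    unfolding Phi2_def lin_ext_def
    by (intro sum.cong refl)
      (simp add: assms scale_diff_right scale_scale scale_mult_left mult.commute)
  also have "\<dots> = scale (qint v i) ((\<Sum>w\<in>?K. scale (?c w) (word w)) * yv Ym)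
                - scale (v powi i) (F_op v b * yv Yp)"
    unfolding F by (simp only: sum_subtractf scale_sum_right sum_distrib_right)
  finally show ?thesis by (simp only: tensor_expand)
qed

definition one_factor :: "int list \<Rightarrow> bool" where
  "one_factor \<alpha> \<longleftrightarrow> set \<alpha> \<subseteq> {1, -1} \<and> (\<forall>i\<in>{1..length \<alpha>}. 0 \<le> sum_list (take i \<alpha>))"

definition weight_seq :: "int list \<Rightarrow> int list" where
  "weight_seq \<alpha> = map (\<lambda>i. sum_list (take i \<alpha>)) [1..<Suc (length \<alpha>)]"

text \<open>The inserted 0 only matters for the empty 1-factor, whose weight sequence is empty: a
  nonempty 1-factor starts with the partial sum 1.\<close>

definition max_weight :: "int list \<Rightarrow> nat" where
  "max_weight \<alpha> = nat (Max (insert 0 (set (weight_seq \<alpha>))))"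

definition shape :: "int list \<Rightarrow> nat \<times> nat" where
  "shape \<alpha> = (let p = count_list \<alpha> (-1) in (length \<alpha> - p, p))"

definition factor_le :: "int list \<Rightarrow> int list \<Rightarrow> bool" (infix "\<preceq>" 50) where
  "\<beta> \<preceq> \<alpha> \<longleftrightarrow> length \<beta> = length \<alpha> \<and>
     (\<forall>j\<in>{1..length \<alpha>}. sum_list (take j \<beta>) \<le> sum_list (take j \<alpha>))"

text \<open>Positions in \<open>pairing\<close> and \<open>defect\<close> count from 0.\<close>

definition pairing :: "int list \<Rightarrow> nat \<Rightarrow> nat \<Rightarrow> bool" where
  "pairing \<alpha> i j \<longleftrightarrow> i < j \<and> j < length \<alpha> \<and> \<alpha> ! i = 1 \<and> (\<Sum>k=i..j. \<alpha> ! k) = 0 \<and>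
     (\<forall>j'. i < j' \<and> j' < j \<longrightarrow> (\<Sum>k=i..j'. \<alpha> ! k) \<noteq> 0)"

definition defect :: "int list \<Rightarrow> nat \<Rightarrow> bool" where
  "defect \<alpha> i \<longleftrightarrow> i < length \<alpha> \<and> (\<nexists>j. pairing \<alpha> i j \<or> pairing \<alpha> j i)"

lemma finite_factors_below: "finite {\<beta>. one_factor \<beta> \<and> shape \<beta> = shape \<alpha> \<and> \<beta> \<preceq> \<alpha>}"
  by (rule finite_subset[OF _ finite_lists_length_eq[of "{1, -1::int}" "length \<alpha>"]])
    (auto simp: one_factor_def factor_le_def)

definition mu :: "'a::field \<Rightarrow> int list \<Rightarrow> 'a tensor" where
  "mu v \<alpha> = foldl (\<lambda>b a. if a = 1 then Phi1 b else Phi2 v b) 1 \<alpha>"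

definition Psi :: "'a::field \<Rightarrow> 'a tensor \<Rightarrow> 'a tensor" where
  "Psi v b = yv Yp * b * yv Ym - scale v (yv Ym * b * yv Yp)"

text \<open>If position 0 of \<open>a # \<alpha>\<close> is paired with position j, the entries strictly between them
  are \<open>take (j - 1) \<alpha>\<close>, and those after j are \<open>drop j \<alpha>\<close>.\<close>

function eta :: "'a::field \<Rightarrow> int list \<Rightarrow> 'a tensor" where
  "eta v [] = 1"
| "eta v (a # \<alpha>) =
     (if defect (a # \<alpha>) 0 then yv Yp * eta v \<alpha>
      else let j = (THE j. pairing (a # \<alpha>) 0 j)
           in Psi v (eta v (take (j - 1) \<alpha>)) * eta v (drop j \<alpha>))"
  by pat_completeness auto
termination by (relation "measure (\<lambda>(v, \<alpha>). length \<alpha>)") auto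

text \<open>A monomial maps each index i to the exponent of t_i; a polynomial maps each monomial to its
  coefficient, here a nonnegative integer.\<close>

type_synonym nat_mpoly = "(nat \<Rightarrow>\<^sub>0 nat) \<Rightarrow>\<^sub>0 nat"

definition poly_vars :: "nat_mpoly \<Rightarrow> nat set" where
  "poly_vars p = (\<Union>s\<in>Poly_Mapping.keys p. Poly_Mapping.keys s)"

definition poly_eval :: "nat_mpoly \<Rightarrow> (nat \<Rightarrow> 'a::comm_semiring_1) \<Rightarrow> 'a" where
  "poly_eval p x = (\<Sum>s\<in>Poly_Mapping.keys p. of_nat (Poly_Mapping.lookup p s) *
      (\<Prod>i\<in>Poly_Mapping.keys s. x i ^ Poly_Mapping.lookup s i))"

end

theory Submission
  imports Defs
begin

text \<open>The vectors \<open>mu v \<alpha>\<close> are built by appending one entry of \<open>\<alpha>\<close> at a time, so it suffices to know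
  what the two operators do to a vector \<open>eta v \<beta>\<close>. The first one only appends a defect:
  it sends \<open>eta v \<beta>\<close> to \<open>eta v (\<beta> @ [1])\<close>.

  For the second one, let \<open>\<beta>\<close> have \<open>i\<close> defects. Between the defects, \<open>eta v \<beta>\<close> consists of nested
  links, which have weight 0 and are killed by \<open>F\<close> (\<open>F_op_eta_balanced\<close>). Hence \<open>F\<close> acts on
  the defects only. View the position appended by the operator as a further slot, and let \<open>X k\<close>, for
  \<open>1 \<le> k \<le> i + 1\<close>, be the tensor with \<open>y_{-1}\<close> in the \<open>k\<close>-th slot and \<open>y_1\<close> in the other slots. Then
  the image of \<open>eta v \<beta>\<close> is \<open>[i] X (i + 1) - (v X 1 + v^2 X 2 + ... + v^i X i)\<close>. On the other
  hand, \<open>X (k + 1) - v X k\<close> is the result of linking the slots \<open>k\<close> and \<open>k + 1\<close>, so it is again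
  \<open>eta v \<gamma>\<close> for some 1-factor \<open>\<gamma>\<close>. Since \<open>v [k] = v^k + [k - 1]\<close>, a comparison of coefficients gives
  that the image of \<open>eta v \<beta>\<close> is the sum of the \<open>i\<close> possible links of neighbouring slots, the \<open>k\<close>-th one
  with coefficient \<open>[k]\<close> (\<open>Phi2_eta_expansion\<close>). The formal proof runs this comparison as
  an induction that splits off the last defect (\<open>Phi2_eta_last_defect\<close>).

  All coefficients are therefore sums of products of \<open>[1], ..., [m]\<close>, because the number of defects of
  \<open>\<beta>\<close> is the current entry of the weight sequence of \<open>\<alpha>\<close>. Each new link lies
  below \<open>\<beta> @ [-1]\<close> in the order on 1-factors, and only the link of the last two slots ends in \<open>-1\<close>: it
  is \<open>\<beta> @ [-1]\<close> itself and has coefficient \<open>[i]\<close>. So the leading coefficient for \<open>\<alpha>\<close> is a product of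
  quantum integers \<open>[i]\<close> with \<open>1 \<le> i \<le> n\<close>, which are nonzero because \<open>[n]!\<close> is
  (\<open>mu_expansion\<close>).\<close>

section \<open>Linear algebra in the tensor algebra\<close>

lemma scale_add_right: "scale c (x + y) = scale c x + scale c y"
  by (simp add: scale_def algebra_simps)

lemma scale_zero_right [simp]: "scale c 0 = 0"
  by (simp add: scale_def)

lemma scale_one [simp]: "scale 1 x = x"
  by (rule poly_mapping_eqI) (simp add: lookup_scale)

lemma scale_zero_left [simp]: "scale 0 x = 0"
  by (rule poly_mapping_eqI) (simp add: lookup_scale)

lemma scale_add_left: "scale (c + d) x = scale c x + scale d x"
  by (rule poly_mapping_eqI) (simp add: lookup_scale lookup_add algebra_simps)

lemma scale_sum_left: "scale (sum c A) x = (\<Sum>a\<in>A. scale (c a) x)"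
  by (rule poly_mapping_eqI) (simp add: lookup_scale lookup_sum sum_distrib_right)

lemma word_mult: "word u * word w = word (u @ w)"
  by (simp add: mult_single plus_list_def)

lemma word_Nil: "word [] = 1"
  by (metis single_one zero_list_def)

lemma word_mult_scale: "word u * scale c z = scale c (word u * z)"
  by (simp add: scale_def mult.assoc[symmetric] mult_single plus_list_def)

text \<open>Scalars are central, but the tensor algebra is not commutative; expanding \<open>x\<close> in words reduces the
  claim to the empty word commuting with every word.\<close>

lemma scale_mult_right:
  fixes x :: "'a::field tensor"
  shows "x * scale c z = scale c (x * z)"
proof -
  let ?x = "\<Sum>w\<in>Poly_Mapping.keys x. scale (Poly_Mapping.lookup x w) (word w)"
  have "?x * scale c z = scale c (?x * z)"
    by (simp only: sum_distrib_right scale_sum_right scale_mult_left word_mult_scale scale_scale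
        mult.commute)
  then show ?thesis by (simp only: tensor_expand)
qed

text \<open>A sum over a fixed finite set makes additivity visible: the support of a sum of two tensors may
  be smaller than the union of the supports.\<close>

lemma lin_ext_superset:
  assumes "finite A" "Poly_Mapping.keys x \<subseteq> A"
  shows "lin_ext f x = (\<Sum>w\<in>A. scale (Poly_Mapping.lookup x w) (f w))"
  unfolding lin_ext_def using assms
  by (intro sum.mono_neutral_left) (auto simp: in_keys_iff)

lemma lin_ext_add: "lin_ext f (x + y) = lin_ext f x + lin_ext f y"
proof -
  let ?A = "Poly_Mapping.keys x \<union> Poly_Mapping.keys y"
  have A: "finite ?A" "Poly_Mapping.keys (x + y) \<subseteq> ?A"
    "Poly_Mapping.keys x \<subseteq> ?A" "Poly_Mapping.keys y \<subseteq> ?A"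
    using Poly_Mapping.keys_add[of x y] by auto
  show ?thesis
    by (simp only: lin_ext_superset[OF A(1,2)] lin_ext_superset[OF A(1,3)]
        lin_ext_superset[OF A(1,4)] lookup_add scale_add_left sum.distrib)
qed

lemma lin_ext_zero [simp]: "lin_ext f 0 = 0"
  by (simp add: lin_ext_def)

lemma keys_scale_subset: "Poly_Mapping.keys (scale c x) \<subseteq> Poly_Mapping.keys x"
  by (auto simp: in_keys_iff lookup_scale)

lemma lin_ext_scale: "lin_ext f (scale c x) = scale c (lin_ext f x)"
  by (simp add: lin_ext_superset[OF finite_keys keys_scale_subset] lin_ext_def[of f x]
      lookup_scale scale_sum_right scale_scale)

lemma lin_ext_sum: "lin_ext f (sum g A) = (\<Sum>a\<in>A. lin_ext f (g a))"
  by (induction A rule: infinite_finite_induct) (simp_all add: lin_ext_add)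

lemma F_op_scale: "F_op v (scale c x) = scale c (F_op v x)"
  by (simp add: F_op_def lin_ext_scale)

lemma F_op_sum: "F_op v (sum g A) = (\<Sum>a\<in>A. F_op v (g a))"
  by (simp add: F_op_def lin_ext_sum)

lemma F_op_add: "F_op v (x + y) = F_op v x + F_op v y"
  by (simp add: F_op_def lin_ext_add)

lemma F_op_diff: "F_op v (x - y) = F_op v x - F_op v y"
  using F_op_add[of v "x - y" y] by simp

section \<open>Weights and the coproduct rule for the lowering operator\<close>

definition homogeneous :: "'a::field tensor \<Rightarrow> int \<Rightarrow> bool" where
  "homogeneous x i \<longleftrightarrow> (\<forall>w\<in>Poly_Mapping.keys x. weight w = i)"

lemma weight_append: "weight (u @ w) = weight u + weight w"
  by (simp add: weight_def)

lemma homogeneous_mult: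
  assumes "homogeneous x i" "homogeneous y j"
  shows "homogeneous (x * y) (i + j)"
  using keys_mult[of x y] assms
  by (fastforce simp: homogeneous_def plus_list_def weight_append)

lemma homogeneous_diff: "homogeneous x i \<Longrightarrow> homogeneous y i \<Longrightarrow> homogeneous (x - y) i"
  using keys_diff[of x y] by (auto simp: homogeneous_def)

lemma homogeneous_scale: "homogeneous x i \<Longrightarrow> homogeneous (scale c x) i"
  using keys_scale_subset[of c x] by (auto simp: homogeneous_def)

lemma homogeneous_word: "homogeneous (word w) (weight w)"
  by (simp add: homogeneous_def)

lemma homogeneous_one: "homogeneous 1 0"
  using homogeneous_word[of "[]"] by (simp add: word_Nil weight_def)

lemma homogeneous_yv: "homogeneous (yv a) (idx_val a)"
  using homogeneous_word[of "[a]"] by (simp add: weight_def)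

lemma prod_list_Kinv:
  assumes "v \<noteq> 0"
  shows "prod_list (map (Kinv_V v) w) = scale (v powi (- weight w)) (word w)"
proof (induction w)
  case Nil
  then show ?case by (simp add: word_Nil weight_def)
next
  case (Cons a w)
  have "v powi (- weight w) * v powi (- idx_val a) = v powi (- weight (a # w))"
    using assms by (simp add: weight_def add.commute flip: power_int_add)
  moreover have "prod_list (map (Kinv_V v) (a # w)) =
      scale (v powi (- idx_val a)) (yv a) * scale (v powi (- weight w)) (word w)"
    by (simp only: list.map prod_list.Cons Cons Kinv_V_def)
  ultimately show ?case
    by (simp add: scale_mult_left scale_mult_right scale_scale word_mult del: power_int_minus)
qed

lemma F_op_word:
  "F_op v (word w) = (\<Sum>j<length w.
      word (take j w) * F_V (w ! j) * prod_list (map (Kinv_V v) (drop (Suc j) w)))"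
  by (simp add: F_op_def lin_ext_word)

lemma F_op_Nil: "F_op v (word []) = 0"
  by (simp add: F_op_word)

text \<open>Peeling off the first letter: either \<open>F\<close> hits it and \<open>K^{-1}\<close> scales the rest by its weight, or \<open>F\<close> acts
  further to the right.\<close>

lemma F_op_Cons:
  assumes "v \<noteq> 0"
  shows "F_op v (word (a # w)) =
    scale (v powi (- weight w)) (F_V a * word w) + yv a * F_op v (word w)"
proof -
  let ?t = "\<lambda>j. F_V (w ! j) * prod_list (map (Kinv_V v) (drop (Suc j) w))"
  have "F_op v (word (a # w)) =
      F_V a * prod_list (map (Kinv_V v) w) + (\<Sum>j<length w. word (a # take j w) * ?t j)"
    by (simp add: F_op_word sum.lessThan_Suc_shift word_Nil mult.assoc del: sum.lessThan_Suc)
  also have "(\<Sum>j<length w. word (a # take j w) * ?t j) = yv a * F_op v (word w)"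
    unfolding F_op_word sum_distrib_left
    by (intro sum.cong refl) (simp add: word_mult flip: mult.assoc)
  finally show ?thesis
    by (simp only: prod_list_Kinv[OF assms] scale_mult_right)
qed

lemma F_op_one: "F_op v 1 = 0"
  using F_op_Nil[of v] by (simp add: word_Nil)

lemma F_op_yv: "v \<noteq> 0 \<Longrightarrow> F_op v (yv a) = F_V a"
  using F_op_Cons[of v a "[]"] by (simp add: F_op_one weight_def word_Nil)

lemma F_op_word_append:
  assumes "v \<noteq> 0"
  shows "F_op v (word (u @ w)) =
    scale (v powi (- weight w)) (F_op v (word u) * word w) + word u * F_op v (word w)"
proof (induction u)
  case Nil
  then show ?case by (simp add: F_op_one word_Nil)
next
  case (Cons a u)
  have e: "v powi (- weight (u @ w)) = v powi (- weight w) * v powi (- weight u)"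
    using assms by (simp add: weight_append add.commute flip: power_int_add)
  show ?case
    by (simp add: F_op_Cons[OF assms] Cons e scale_scale[symmetric] scale_add_right scale_mult_left
        scale_mult_right distrib_left distrib_right mult.assoc word_mult del: power_int_minus)
       (simp add: word_mult flip: mult.assoc)
qed

text \<open>The coproduct rule \<open>F (x y) = F x . K^{-1} y + x . F y\<close>, with \<open>K^{-1}\<close> replaced by its eigenvalue on
  the homogeneous \<open>y\<close>. It is bilinear, so the case of two words implies it.\<close>

lemma F_op_mult:
  fixes x y :: "'a::field tensor"
  assumes v: "v \<noteq> 0" and y: "homogeneous y i"
  shows "F_op v (x * y) = scale (v powi (- i)) (F_op v x * y) + x * F_op v y"
proof -
  let ?X = "\<Sum>w\<in>Poly_Mapping.keys x. scale (Poly_Mapping.lookup x w) (word w)"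
  let ?Y = "\<Sum>w\<in>Poly_Mapping.keys y. scale (Poly_Mapping.lookup y w) (word w)"
  have "F_op v (?X * ?Y) = (\<Sum>w\<in>Poly_Mapping.keys x. \<Sum>u\<in>Poly_Mapping.keys y.
      scale (Poly_Mapping.lookup x w) (scale (Poly_Mapping.lookup y u) (F_op v (word (w @ u)))))"
    unfolding sum_product F_op_sum scale_mult_left scale_mult_right F_op_scale word_mult
    by (simp add: scale_scale mult.commute)
  also have "\<dots> = (\<Sum>w\<in>Poly_Mapping.keys x. \<Sum>u\<in>Poly_Mapping.keys y.
      scale (Poly_Mapping.lookup x w) (scale (Poly_Mapping.lookup y u)
        (scale (v powi (- i)) (F_op v (word w) * word u) + word w * F_op v (word u))))"
    using y by (intro sum.cong refl) (simp add: F_op_word_append[OF v] homogeneous_def)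
  also have "\<dots> = scale (v powi (- i)) (F_op v ?X * ?Y) + ?X * F_op v ?Y"
    unfolding sum_product F_op_sum F_op_scale scale_mult_left scale_mult_right scale_sum_right
    by (simp only: scale_add_right sum.distrib scale_scale mult_ac)
  finally show ?thesis by (simp only: tensor_expand)
qed

section \<open>The combinatorics of 1-factors\<close>

text \<open>Partial sums of length 0 or beyond the end add no condition; admitting them makes \<open>take\<close> of a
  concatenation easy to handle.\<close>

lemma one_factor_alt:
  "one_factor \<alpha> \<longleftrightarrow> set \<alpha> \<subseteq> {1, -1} \<and> (\<forall>i. 0 \<le> sum_list (take i \<alpha>))"
proof -
  have "0 \<le> sum_list (take i \<alpha>)" if *: "\<forall>i\<in>{1..length \<alpha>}. 0 \<le> sum_list (take i \<alpha>)" for i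
  proof (cases "i = 0 \<or> length \<alpha> = 0")
    case False
    then have "min i (length \<alpha>) \<in> {1..length \<alpha>}" by (auto simp: Suc_le_eq)
    with * have "0 \<le> sum_list (take (min i (length \<alpha>)) \<alpha>)" by blast
    then show ?thesis by (simp add: min_def split: if_splits)
  qed auto
  then show ?thesis by (auto simp: one_factor_def)
qed

lemma factor_le_alt:
  "\<beta> \<preceq> \<alpha> \<longleftrightarrow> length \<beta> = length \<alpha> \<and> (\<forall>j. sum_list (take j \<beta>) \<le> sum_list (take j \<alpha>))"
proof -
  have "sum_list (take i \<beta>) \<le> sum_list (take i \<alpha>)"
    if l: "length \<beta> = length \<alpha>"
      and *: "\<forall>j\<in>{1..length \<alpha>}. sum_list (take j \<beta>) \<le> sum_list (take j \<alpha>)" for i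
  proof (cases "i = 0 \<or> length \<alpha> = 0")
    case False
    then have "min i (length \<alpha>) \<in> {1..length \<alpha>}" by (auto simp: Suc_le_eq)
    with * have "sum_list (take (min i (length \<alpha>)) \<beta>) \<le> sum_list (take (min i (length \<alpha>)) \<alpha>)"
      by blast
    with l show ?thesis by (simp add: min_def split: if_splits)
  qed (use l in auto)
  then show ?thesis by (auto simp: factor_le_def)
qed

text \<open>A 1-factor without defects; the partial sums trace a Dyck path.\<close>

definition balanced :: "int list \<Rightarrow> bool" where
  "balanced D \<longleftrightarrow> one_factor D \<and> sum_list D = 0"

lemma one_factor_sum_nonneg: "one_factor \<alpha> \<Longrightarrow> 0 \<le> sum_list \<alpha>"
  unfolding one_factor_alt by (metis order_refl take_all)

lemma one_factor_Nil: "one_factor []"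
  by (simp add: one_factor_def)

lemma one_factor_append: "one_factor \<alpha> \<Longrightarrow> one_factor \<beta> \<Longrightarrow> one_factor (\<alpha> @ \<beta>)"
  by (simp add: one_factor_alt)

lemma one_factor_Cons: "one_factor \<gamma> \<Longrightarrow> one_factor (1 # \<gamma>)"
  using one_factor_append[of "[1]" \<gamma>] by (simp add: one_factor_def)

lemma one_factor_snoc:
  "one_factor (\<alpha> @ [a]) \<longleftrightarrow> one_factor \<alpha> \<and> a \<in> {1, -1} \<and> 0 \<le> sum_list \<alpha> + a"
proof
  assume L: "one_factor (\<alpha> @ [a])"
  have "0 \<le> sum_list (take i \<alpha>)" for i
  proof -
    have "0 \<le> sum_list (take (min i (length \<alpha>)) (\<alpha> @ [a]))"
      using L by (simp only: one_factor_alt)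
    then show ?thesis by (simp add: min_def split: if_splits)
  qed
  with L one_factor_sum_nonneg[OF L] show "one_factor \<alpha> \<and> a \<in> {1, -1} \<and> 0 \<le> sum_list \<alpha> + a"
    by (auto simp: one_factor_alt)
next
  assume "one_factor \<alpha> \<and> a \<in> {1, -1} \<and> 0 \<le> sum_list \<alpha> + a"
  then show "one_factor (\<alpha> @ [a])"
    by (auto simp: one_factor_alt take_Cons' not_le)
qed

lemma balanced_link: "balanced D \<Longrightarrow> balanced (1 # D @ [-1])"
  using one_factor_Cons[of D] one_factor_snoc[of "1 # D" "-1"] by (simp add: balanced_def)

text \<open>The decomposition at the first entry, which parallels the recursion for \<open>eta\<close>. The first entry is
  always 1. If the partial sums never return to 0, it is a defect and the rest is a 1-factor. Otherwise the
  first return to 0 is its partner, which encloses a balanced part and leaves a 1-factor behind.\<close>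

lemma one_factor_induct [consumes 1, case_names Nil defect link]:
  assumes "one_factor \<beta>"
    and "P []"
    and "\<And>\<gamma>. one_factor \<gamma> \<Longrightarrow> P \<gamma> \<Longrightarrow> P (1 # \<gamma>)"
    and "\<And>D \<gamma>. balanced D \<Longrightarrow> P D \<Longrightarrow> one_factor \<gamma> \<Longrightarrow> P \<gamma> \<Longrightarrow> P (1 # D @ (-1) # \<gamma>)"
  shows "P \<beta>"
  using assms(1)
proof (induction \<beta> rule: length_induct)
  case (1 \<beta>)
  show ?case
  proof (cases \<beta>)
    case Nil
    with assms(2) show ?thesis by simp
  next
    case (Cons a \<gamma>)
    have psum: "0 \<le> sum_list (take j \<beta>)" for j
      using 1(2) by (simp add: one_factor_alt)
    have set: "set \<beta> \<subseteq> {1, -1}" using 1(2) by (simp add: one_factor_alt)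
    have a: "a = 1" using psum[of 1] set Cons by auto
    have ge: "- 1 \<le> sum_list (take j \<gamma>)" for j
      using psum[of "Suc j"] by (simp add: Cons a)
    show ?thesis
    proof (cases "\<exists>j. sum_list (take j \<gamma>) = -1")
      case False
      have "0 \<le> sum_list (take j \<gamma>)" for j
        using ge[of j] False by (metis add.commute add.right_inverse linorder_not_less order_le_less zless_imp_add1_zle)
      then have "one_factor \<gamma>"
        using set Cons by (auto simp: one_factor_alt)
      with 1 assms(3) Cons a show ?thesis by simp
    next
      case True
      (* After dropping the leading 1, the first return to 0 is the first partial sum -1. *)
      define j where "j = (LEAST j. sum_list (take j \<gamma>) = -1)"
      have j: "sum_list (take j \<gamma>) = -1" unfolding j_def using True by (rule LeastI_ex)
      have before: "0 \<le> sum_list (take i \<gamma>)" if "i < j" for i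
        using not_less_Least[OF that[unfolded j_def]] ge[of i] by linarith
      have "j \<noteq> 0" using j by (intro notI) simp
      then obtain k where k: "j = Suc k" by (cases j) auto
      have kl: "k < length \<gamma>" using before[of k] j k by (cases "k < length \<gamma>") auto
      let ?D = "take k \<gamma>" and ?\<delta> = "drop j \<gamma>"
      have e: "take j \<gamma> = ?D @ [\<gamma> ! k]" using kl k by (simp add: take_Suc_conv_app_nth)
      have "\<gamma> ! k \<in> {1, -1}" using set Cons nth_mem[OF kl] by (meson set_subset_Cons subsetD)
      with j e before[of k] k have D0: "\<gamma> ! k = -1" "sum_list ?D = 0" by auto
      have split: "\<beta> = 1 # ?D @ (-1) # ?\<delta>"
        using Cons a kl k D0(1) id_take_nth_drop[of k \<gamma>] by simp
      have "one_factor ?D"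
        using set Cons before k by (auto simp: one_factor_alt dest: in_set_takeD)
      then have D: "balanced ?D" using D0 by (simp add: balanced_def)
      have "0 \<le> sum_list (take i ?\<delta>)" for i
        using ge[of "j + i"] j by (simp add: take_add)
      then have d: "one_factor ?\<delta>"
        using set Cons by (auto simp: one_factor_alt dest: in_set_dropD)
      have "P ?D" "P ?\<delta>"
        using 1(1) D d Cons by (auto simp: balanced_def)
      with assms(4)[OF D _ d] split show ?thesis by simp
    qed
  qed
qed

text \<open>Whatever follows the last defect is balanced, hence invisible to \<open>F\<close>. This decomposition therefore
  suits an induction on the number of defects when the operators append at the right end.\<close>

lemma one_factor_last_defect:
  assumes \<beta>: "one_factor \<beta>" and pos: "0 < sum_list \<beta>"
  obtains \<beta>' D where "\<beta> = \<beta>' @ 1 # D" "one_factor \<beta>'" "balanced D"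
    "sum_list \<beta>' = sum_list \<beta> - 1"
proof -
  have "\<exists>\<beta>' D. \<beta> = \<beta>' @ 1 # D \<and> one_factor \<beta>' \<and> balanced D"
    using assms
  proof (induction \<beta> rule: one_factor_induct)
    case Nil
    then show ?case by simp
  next
    case (defect \<gamma>)
    show ?case
    proof (cases "sum_list \<gamma> = 0")
      case True
      with defect.hyps have "balanced \<gamma>" by (simp add: balanced_def)
      then show ?thesis using one_factor_Nil by fastforce
    next
      case False
      with defect one_factor_sum_nonneg[OF defect.hyps]
      obtain \<beta>' D where "\<gamma> = \<beta>' @ 1 # D" "one_factor \<beta>'" "balanced D" by auto
      then show ?thesis using one_factor_Cons by (metis append_Cons)
    qed
  next
    case (link D \<gamma>)
    then have "sum_list \<gamma> > 0" by (simp add: balanced_def)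
    with link obtain \<beta>' D' where *: "\<gamma> = \<beta>' @ 1 # D'" "one_factor \<beta>'" "balanced D'" by auto
    have "one_factor ((1 # D @ [-1]) @ \<beta>')"
      using balanced_link[OF link.hyps(1)] *(2) by (intro one_factor_append) (simp_all add: balanced_def)
    with * show ?case by (intro exI[of _ "(1 # D @ [-1]) @ \<beta>'"] exI[of _ D']) simp
  qed
  then show thesis using that by (auto simp: balanced_def)
qed

lemma factor_le_refl: "\<alpha> \<preceq> \<alpha>"
  by (simp add: factor_le_def)

lemma factor_le_trans: "\<alpha> \<preceq> \<beta> \<Longrightarrow> \<beta> \<preceq> \<gamma> \<Longrightarrow> \<alpha> \<preceq> \<gamma>"
  unfolding factor_le_alt by (metis order_trans)

lemma factor_le_append: "\<alpha> \<preceq> \<beta> \<Longrightarrow> \<gamma> \<preceq> \<delta> \<Longrightarrow> \<alpha> @ \<gamma> \<preceq> \<beta> @ \<delta>"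
  by (simp add: factor_le_alt add_mono)

text \<open>Both sides have the same total, and left of the last entry the partial sums differ by 2. This is why
  moving the newly created \<open>-1\<close> to the left of a balanced part goes down in the order.\<close>

lemma factor_le_swap: "(-1) # D @ [1] \<preceq> 1 # D @ [-1]"
proof -
  have "sum_list (take j ((-1) # D @ [1])) \<le> sum_list (take j (1 # D @ [-1]))" for j
    by (cases j; cases "j - Suc (length D)") auto
  then show ?thesis by (simp add: factor_le_alt)
qed

section \<open>The vectors attached to 1-factors\<close>

text \<open>The recursion for \<open>eta\<close> asks only about pairings of the first entry, and for these the sums in the
  definition are partial sums of the whole sequence.\<close>

lemma pairing_0_iff:
  "pairing \<alpha> 0 j \<longleftrightarrow> 0 < j \<and> j < length \<alpha> \<and> \<alpha> ! 0 = 1 \<and> sum_list (take (Suc j) \<alpha>) = 0 \<and>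
     (\<forall>j'. 0 < j' \<and> j' < j \<longrightarrow> sum_list (take (Suc j') \<alpha>) \<noteq> 0)"
proof -
  have "(\<Sum>k=0..i. \<alpha> ! k) = sum_list (take (Suc i) \<alpha>)" if "i < length \<alpha>" for i
    using that by (simp add: sum_list_sum_nth atLeastLessThanSuc_atLeastAtMost min.absorb2 Suc_leI)
  then show ?thesis unfolding pairing_def by auto
qed

lemma eta_defect:
  assumes "one_factor \<gamma>"
  shows "eta v (1 # \<gamma>) = yv Yp * eta v \<gamma>"
proof -
  have "\<not> pairing (1 # \<gamma>) 0 j" for j
  proof -
    have "sum_list (take (Suc j) (1 # \<gamma>)) > 0"
      using assms by (simp add: one_factor_alt add_pos_nonneg)
    then show ?thesis by (simp add: pairing_0_iff)
  qed
  moreover have "\<not> pairing (1 # \<gamma>) j 0" for j by (simp add: pairing_def)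
  ultimately have "defect (1 # \<gamma>) 0" by (simp add: defect_def)
  then show ?thesis by simp
qed

lemma eta_link:
  assumes "balanced D"
  shows "eta v (1 # D @ (-1) # \<gamma>) = Psi v (eta v D) * eta v \<gamma>"
proof -
  let ?l = "Suc (length D)"
  have D: "0 \<le> sum_list (take j D)" "sum_list D = 0" for j
    using assms by (auto simp: balanced_def one_factor_alt)
  have before: "sum_list (take (Suc j) (1 # D @ (-1) # \<gamma>)) \<noteq> 0" if "j < ?l" for j
    using that D(1)[of j] by simp
  have l: "pairing (1 # D @ (-1) # \<gamma>) 0 ?l"
    using before D(2) by (auto simp: pairing_0_iff)
  moreover have "j = ?l" if "pairing (1 # D @ (-1) # \<gamma>) 0 j" for j
  proof (rule ccontr)
    assume "j \<noteq> ?l"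
    then consider "j < ?l" | "?l < j" by linarith
    then show False
      using that l by cases (auto simp: pairing_0_iff before)
  qed
  ultimately have "(THE j. pairing (1 # D @ (-1) # \<gamma>) 0 j) = ?l" by (rule the_equality)
  moreover have "\<not> defect (1 # D @ (-1) # \<gamma>) 0" using l by (auto simp: defect_def)
  ultimately show ?thesis by simp
qed

text \<open>No \<open>-1\<close> in the 1-factor \<open>\<gamma>\<close> is left over to be paired with a defect of \<open>\<beta>\<close>, so the links of the
  two parts do not interact.\<close>

lemma eta_append:
  assumes "one_factor \<beta>" "one_factor \<gamma>"
  shows "eta v (\<beta> @ \<gamma>) = eta v \<beta> * eta v \<gamma>"
  using assms(1)
proof (induction \<beta> rule: one_factor_induct)
  case (defect \<delta>)
  with assms(2) show ?case
    by (simp add: eta_defect one_factor_append mult.assoc del: eta.simps)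
next
  case (link D \<delta>)
  then show ?case
    by (simp add: eta_link mult.assoc del: eta.simps)
qed simp

lemma eta_singleton: "eta v [1] = yv Yp"
  using eta_defect[OF one_factor_Nil, of v] by simp

lemma homogeneous_Psi:
  assumes "homogeneous b i"
  shows "homogeneous (Psi v b) i"
proof -
  have "homogeneous (yv Yp * b * yv Ym) (1 + i + - 1)" "homogeneous (yv Ym * b * yv Yp) (- 1 + i + 1)"
    using homogeneous_mult[OF homogeneous_mult[OF homogeneous_yv assms] homogeneous_yv]
    by (metis idx_val.simps)+
  then show ?thesis
    unfolding Psi_def by (intro homogeneous_diff homogeneous_scale) simp_all
qed

lemma homogeneous_eta:
  assumes "one_factor \<beta>"
  shows "homogeneous (eta v \<beta>) (sum_list \<beta>)"
  using assms
proof (induction \<beta> rule: one_factor_induct)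
  case Nil
  then show ?case by (simp add: homogeneous_one)
next
  case (defect \<gamma>)
  then show ?case
    using homogeneous_mult[OF homogeneous_yv[of Yp], of "eta v \<gamma>" "sum_list \<gamma>"]
    by (simp add: eta_defect del: eta.simps)
next
  case (link D \<gamma>)
  then show ?case
    using homogeneous_mult[OF homogeneous_Psi, of "eta v D" "sum_list D" "eta v \<gamma>" "sum_list \<gamma>" v]
    by (simp add: eta_link balanced_def del: eta.simps)
qed

text \<open>The two terms in which \<open>F\<close> turns the remaining \<open>y_1\<close> of the link into \<open>y_{-1}\<close> cancel: in the first
  one, passing \<open>K^{-1}\<close> over \<open>y_{-1}\<close> contributes the factor \<open>v\<close> that the second one carries by
  definition.\<close>

lemma F_op_Psi:
  assumes v: "v \<noteq> 0" and b: "homogeneous b 0" "F_op v b = 0"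
  shows "F_op v (Psi v b) = 0"
proof -
  have h: "homogeneous (b * yv a) (idx_val a)" for a
    using homogeneous_mult[OF b(1) homogeneous_yv] by simp
  have F: "F_op v (yv c * (b * yv a)) =
      scale (v powi (- idx_val a)) (F_V c * (b * yv a)) + yv c * (b * F_V a)" for a c
    by (simp add: F_op_mult[OF v h] F_op_mult[OF v homogeneous_yv] b(2) F_op_yv[OF v])
  show ?thesis
    by (simp add: Psi_def mult.assoc F_op_diff F_op_scale F)
qed

lemma F_op_eta_balanced:
  assumes v: "v \<noteq> 0" and D: "balanced D"
  shows "F_op v (eta v D) = 0"
proof -
  have "one_factor D" "sum_list D = 0" using D by (auto simp: balanced_def)
  then show ?thesis
  proof (induction D rule: one_factor_induct)
    case Nil
    then show ?case by (simp add: F_op_one)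
  next
    case (defect \<gamma>)
    then show ?case using one_factor_sum_nonneg[of \<gamma>] by simp
  next
    case (link D \<gamma>)
    then have D: "one_factor D" "sum_list D = 0" and g: "sum_list \<gamma> = 0"
      by (auto simp: balanced_def)
    have "homogeneous (eta v D) 0"
      using homogeneous_eta[OF D(1), of v] by (simp only: D(2))
    then have "F_op v (Psi v (eta v D)) = 0"
      by (rule F_op_Psi[OF v _ link.IH(1)[OF D(2)]])
    moreover have "F_op v (eta v \<gamma>) = 0"
      by (rule link.IH(2)[OF g])
    ultimately show ?case
      unfolding eta_link[OF link.hyps(1)] F_op_mult[OF v homogeneous_eta[OF link.hyps(2)]]
      by simp
  qed
qed

section \<open>The second operator on the vectors attached to 1-factors\<close>

lemma qint_zero: "qint v 0 = 0"
  by (simp add: qint_def)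

lemma qint_rec:
  assumes "v \<noteq> 0"
  shows "v * qint v (int (Suc i)) = v powi int (Suc i) + qint v (int i)"
proof -
  have q: "qint v (int j) = (\<Sum>t<j. v powi (int j - 1 - 2 * int t))" for j
    by (simp add: qint_def)
  have "v * v powi (int (Suc i) - 1 - 2 * int t) = v powi (int (Suc i) - 2 * int t)" for t
    using power_int_add[of v 1 "int (Suc i) - 1 - 2 * int t"] assms by (simp add: algebra_simps)
  then have "v * qint v (int (Suc i)) = (\<Sum>t<Suc i. v powi (int (Suc i) - 2 * int t))"
    unfolding q sum_distrib_left by (intro sum.cong) simp_all
  also have "\<dots> = v powi int (Suc i) + (\<Sum>t<i. v powi (int i - 1 - 2 * int t))"
    unfolding sum.lessThan_Suc_shift by (simp add: algebra_simps)
  finally show ?thesis by (simp only: q)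
qed

lemma Phi2_homogeneous:
  assumes "homogeneous b i"
  shows "Phi2 v b = scale (qint v i) (b * yv Ym) - scale (v powi i) (F_op v b * yv Yp)"
  using assms by (intro Phi2_weight) (simp add: homogeneous_def)

text \<open>Without defects the weight is 0, and both terms of the operator vanish.\<close>

lemma Phi2_eta_balanced:
  assumes "v \<noteq> 0" "balanced D"
  shows "Phi2 v (eta v D) = 0"
  using Phi2_homogeneous[OF homogeneous_eta, of D v v] F_op_eta_balanced[OF assms] assms(2)
  by (simp add: balanced_def qint_zero)

text \<open>By the coproduct rule, \<open>F\<close> acts either on \<open>eta v \<beta>\<close> or on the last defect. The first kind of term,
  with its factor \<open>v^(i+1) v^{-1} = v^i\<close>, is already part of \<open>Phi2 v (eta v \<beta>)\<close>. The remaining terms place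
  \<open>y_{-1}\<close> in the new slot, with coefficient \<open>[i + 1]\<close>, or at the last defect, with coefficient
  \<open>- v^(i+1) - [i] = - v [i + 1]\<close>, where \<open>[i]\<close> compensates for the leading term of
  \<open>Phi2 v (eta v \<beta>)\<close>. Together they form \<open>[i + 1]\<close> times a link.\<close>

lemma Phi2_eta_last_defect:
  assumes v: "v \<noteq> 0" and \<beta>: "one_factor \<beta>" and D: "balanced D" and i: "sum_list \<beta> = int i"
  shows "Phi2 v (eta v (\<beta> @ 1 # D)) =
    Phi2 v (eta v \<beta>) * eta v D * yv Yp + scale (qint v (int (Suc i))) (eta v (\<beta> @ 1 # D @ [-1]))"
proof -
  let ?b = "eta v \<beta>" and ?d = "eta v D"
  have oD: "one_factor D" and D0: "sum_list D = 0" using D by (auto simp: balanced_def)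
  have hb: "homogeneous ?b (int i)" and hd: "homogeneous ?d 0"
    using homogeneous_eta[OF \<beta>, of v] homogeneous_eta[OF oD, of v] i D0 by auto
  have e1: "eta v (\<beta> @ 1 # D) = ?b * (yv Yp * ?d)"
    using eta_append[OF \<beta> one_factor_Cons[OF oD]] by (simp add: eta_defect[OF oD] del: eta.simps)
  have e2: "eta v (\<beta> @ 1 # D @ [-1]) = ?b * Psi v ?d"
    using eta_append[OF \<beta>, of "1 # D @ [-1]" v] balanced_link[OF D] eta_link[OF D, of v "[]"]
    by (simp add: balanced_def del: eta.simps(2))
  have hyd: "homogeneous (yv Yp * ?d) 1"
    using homogeneous_mult[OF homogeneous_yv[of Yp] hd] by simp
  have h: "homogeneous (?b * (yv Yp * ?d)) (int (Suc i))"
    using homogeneous_mult[OF hb hyd] by (simp add: algebra_simps)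
  have F: "F_op v (?b * (yv Yp * ?d)) =
      scale (inverse v) (F_op v ?b * (yv Yp * ?d)) + ?b * (yv Ym * ?d)"
    using F_op_mult[OF v hyd, of ?b] F_op_mult[OF v hd, of "yv Yp"]
    by (simp add: F_op_yv[OF v] F_op_eta_balanced[OF v D])
  have p: "v powi int (Suc i) * inverse v = v powi int i"
    using power_int_add[of v "int i" 1] v by (simp add: add.commute)
  have q: "v powi int (Suc i) = v * qint v (int (Suc i)) - qint v (int i)"
    using qint_rec[OF v, of i] by simp
  let ?A = "?b * (yv Ym * (?d * yv Yp))"
  have "Phi2 v (eta v (\<beta> @ 1 # D)) =
      scale (qint v (int (Suc i))) (?b * (yv Yp * (?d * yv Ym)))
      - scale (v powi int i) (F_op v ?b * (yv Yp * (?d * yv Yp)))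
      - scale (v powi int (Suc i)) ?A"
    unfolding e1 Phi2_homogeneous[OF h] F
    by (simp only: mult.assoc distrib_right scale_mult_left scale_add_right scale_scale p
        diff_diff_add)
  also have "scale (v powi int (Suc i)) ?A =
      scale (v * qint v (int (Suc i))) ?A - scale (qint v (int i)) ?A"
    unfolding q by (metis add_diff_cancel_right' diff_add_cancel scale_add_left)
  finally show ?thesis
    unfolding e2 Phi2_homogeneous[OF hb] Psi_def
    by (simp add: mult.assoc left_diff_distrib right_diff_distrib scale_mult_left scale_mult_right
        scale_diff_right scale_scale mult.commute[of v])
qed

text \<open>The intended \<open>g k\<close> arises from \<open>\<beta> @ [1]\<close> by linking its \<open>k\<close>-th and \<open>(k+1)\<close>-st defect, i.e. by turning the
  latter into \<open>-1\<close>. Only the consequences below matter: the last two conditions ensure that \<open>g i\<close> is the only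
  term equal to \<open>\<beta> @ [-1]\<close>.\<close>

definition Phi2_terms :: "'a::field \<Rightarrow> int list \<Rightarrow> nat \<Rightarrow> (nat \<Rightarrow> int list) \<Rightarrow> bool" where
  "Phi2_terms v \<beta> i g \<longleftrightarrow>
    Phi2 v (eta v \<beta>) = (\<Sum>k=1..i. scale (qint v (int k)) (eta v (g k))) \<and>
    (\<forall>k\<in>{1..i}. one_factor (g k) \<and> g k \<preceq> \<beta> @ [-1] \<and>
      count_list (g k) (-1) = Suc (count_list \<beta> (-1))) \<and>
    (\<forall>k\<in>{1..<i}. last (g k) = 1) \<and> (0 < i \<longrightarrow> g i = \<beta> @ [-1])"

text \<open>Induction on the number of defects. Splitting off the last one, \<open>\<beta> = \<beta>' @ 1 # D\<close>, the terms for \<open>\<beta>'\<close> get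
  \<open>D @ [1]\<close> appended, and a new term links the last defect with the new position.\<close>

lemma Phi2_eta_expansion:
  fixes v :: "'a::field"
  assumes v: "v \<noteq> 0" and "one_factor \<beta>" and "sum_list \<beta> = int i"
  shows "\<exists>g. Phi2_terms v \<beta> i g"
  using assms(2,3)
proof (induction i arbitrary: \<beta>)
  case 0
  then have "balanced \<beta>" by (simp add: balanced_def)
  then show ?case using Phi2_eta_balanced[OF v] by (simp add: Phi2_terms_def)
next
  case (Suc i)
  obtain \<beta>' D where \<beta>: "\<beta> = \<beta>' @ 1 # D" and \<beta>': "one_factor \<beta>'" and D: "balanced D"
    and s: "sum_list \<beta>' = int i"
    using one_factor_last_defect[OF Suc.prems(1)] Suc.prems(2) by (metis add_diff_cancel_left' int_ops(4) of_nat_0_less_iff zero_less_Suc add.commute)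
  have oD: "one_factor D" and D0: "sum_list D = 0" using D by (auto simp: balanced_def)
  have oD1: "one_factor (D @ [1])" using oD D0 by (simp add: one_factor_snoc)
  obtain g where IH: "Phi2_terms v \<beta>' i g"
    using Suc.IH[OF \<beta>' s] by blast
  then have sum: "Phi2 v (eta v \<beta>') = (\<Sum>k=1..i. scale (qint v (int k)) (eta v (g k)))"
    by (simp add: Phi2_terms_def)
  have g: "one_factor (g k) \<and> g k \<preceq> \<beta>' @ [-1] \<and>
      count_list (g k) (-1) = Suc (count_list \<beta>' (-1))" if "k \<in> {1..i}" for k
    using IH that by (simp add: Phi2_terms_def)
  define h where "h k = (if k = Suc i then \<beta> @ [-1] else g k @ D @ [1])" for k
  have eta_h: "eta v (h k) = eta v (g k) * eta v D * yv Yp" if "k \<in> {1..i}" for k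
  proof -
    have "eta v (D @ [1]) = eta v D * yv Yp"
      using eta_append[OF oD, of "[1]" v] one_factor_Cons[OF one_factor_Nil]
      by (simp only: eta_singleton)
    then show ?thesis
      using that g[OF that] eta_append[of "g k" "D @ [1]" v] oD1
      by (simp add: h_def mult.assoc)
  qed
  have "Phi2 v (eta v \<beta>) = (\<Sum>k=1..i. scale (qint v (int k)) (eta v (g k))) * eta v D * yv Yp
      + scale (qint v (int (Suc i))) (eta v (h (Suc i)))"
    using Phi2_eta_last_defect[OF v \<beta>' D s] by (simp add: \<beta> sum h_def)
  also have "\<dots> = (\<Sum>k=1..Suc i. scale (qint v (int k)) (eta v (h k)))"
    by (simp add: sum_distrib_right scale_mult_left eta_h)
  finally have 1: "Phi2 v (eta v \<beta>) = \<dots>" .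
  have 2: "one_factor (h k) \<and> h k \<preceq> \<beta> @ [-1] \<and>
      count_list (h k) (-1) = Suc (count_list \<beta> (-1))"
    if "k \<in> {1..Suc i}" for k
  proof (cases "k = Suc i")
    case True
    then show ?thesis
      using Suc.prems by (simp add: h_def one_factor_snoc factor_le_refl)
  next
    case False
    then have k: "k \<in> {1..i}" using that by auto
    note gk = g[OF k]
    have "g k @ D @ [1] \<preceq> (\<beta>' @ [-1]) @ D @ [1]"
      using gk by (intro factor_le_append factor_le_refl) simp
    also have "(\<beta>' @ [-1]) @ D @ [1] = \<beta>' @ (-1) # D @ [1]" by simp
    finally have "g k @ D @ [1] \<preceq> \<beta>' @ 1 # D @ [-1]"
      using factor_le_append[OF factor_le_refl factor_le_swap] factor_le_trans by blast
    then show ?thesis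
      using gk False oD1 D0 by (auto simp: h_def \<beta> one_factor_append)
  qed
  show ?case
    using 1 2 by (intro exI[of _ h]) (auto simp: h_def Phi2_terms_def)
qed

section \<open>Values of polynomials with nonnegative integer coefficients\<close>

text \<open>Since the coefficients only have to be values of polynomials, it suffices to work with the set of
  all such values and its closure properties; the polynomials themselves are chosen at the very end.\<close>

definition poly_values :: "(nat \<Rightarrow> 'a::comm_semiring_1) \<Rightarrow> nat \<Rightarrow> 'a set" where
  "poly_values x m = {poly_eval p x | p. poly_vars p \<subseteq> {1..m}}"

definition monomial_eval :: "(nat \<Rightarrow> 'a::comm_semiring_1) \<Rightarrow> (nat \<Rightarrow>\<^sub>0 nat) \<Rightarrow> 'a" where
  "monomial_eval x s = (\<Prod>i\<in>Poly_Mapping.keys s. x i ^ Poly_Mapping.lookup s i)"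

lemma monomial_eval_superset:
  assumes "finite A" "Poly_Mapping.keys s \<subseteq> A"
  shows "monomial_eval x s = (\<Prod>i\<in>A. x i ^ Poly_Mapping.lookup s i)"
  unfolding monomial_eval_def using assms
  by (intro prod.mono_neutral_left) (auto simp: in_keys_iff)

lemma monomial_eval_add: "monomial_eval x (s + t) = monomial_eval x s * monomial_eval x t"
proof -
  let ?A = "Poly_Mapping.keys s \<union> Poly_Mapping.keys t"
  have A: "finite ?A" "Poly_Mapping.keys (s + t) \<subseteq> ?A"
    "Poly_Mapping.keys s \<subseteq> ?A" "Poly_Mapping.keys t \<subseteq> ?A"
    using Poly_Mapping.keys_add[of s t] by auto
  show ?thesis
    by (simp only: monomial_eval_superset[OF A(1,2)] monomial_eval_superset[OF A(1,3)]
        monomial_eval_superset[OF A(1,4)] lookup_add power_add prod.distrib)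
qed

lemma poly_eval_superset:
  assumes "finite A" "Poly_Mapping.keys p \<subseteq> A"
  shows "poly_eval p x = (\<Sum>s\<in>A. of_nat (Poly_Mapping.lookup p s) * monomial_eval x s)"
  unfolding poly_eval_def monomial_eval_def[symmetric] using assms
  by (intro sum.mono_neutral_left) (auto simp: in_keys_iff)

lemma poly_eval_add: "poly_eval (p + q) x = poly_eval p x + poly_eval q x"
proof -
  let ?A = "Poly_Mapping.keys p \<union> Poly_Mapping.keys q"
  have A: "finite ?A" "Poly_Mapping.keys (p + q) \<subseteq> ?A"
    "Poly_Mapping.keys p \<subseteq> ?A" "Poly_Mapping.keys q \<subseteq> ?A"
    using Poly_Mapping.keys_add[of p q] by auto
  show ?thesis
    by (simp only: poly_eval_superset[OF A(1,2)] poly_eval_superset[OF A(1,3)]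
        poly_eval_superset[OF A(1,4)] lookup_add of_nat_add distrib_right sum.distrib)
qed

lemma poly_eval_single: "poly_eval (Poly_Mapping.single s c) x = of_nat c * monomial_eval x s"
  by (simp add: poly_eval_superset[of "{s}"])

lemma poly_vars_add: "poly_vars (p + q) \<subseteq> poly_vars p \<union> poly_vars q"
  using Poly_Mapping.keys_add[of p q] by (auto simp: poly_vars_def)

lemma poly_values_zero: "0 \<in> poly_values x m"
  unfolding poly_values_def by (rule CollectI, rule exI[of _ 0]) (simp add: poly_eval_def poly_vars_def)

lemma poly_values_one: "1 \<in> poly_values x m"
  unfolding poly_values_def
  by (rule CollectI, rule exI[of _ "Poly_Mapping.single 0 1"])
    (simp add: poly_eval_single poly_vars_def monomial_eval_def)

lemma poly_values_add:
  assumes "a \<in> poly_values x m" "b \<in> poly_values x m"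
  shows "a + b \<in> poly_values x m"
proof -
  obtain p q where "a = poly_eval p x" "b = poly_eval q x"
    "poly_vars p \<subseteq> {1..m}" "poly_vars q \<subseteq> {1..m}"
    using assms by (auto simp: poly_values_def)
  then show ?thesis
    using poly_vars_add[of p q] unfolding poly_values_def
    by (intro CollectI exI[of _ "p + q"]) (auto simp: poly_eval_add)
qed

lemma poly_values_sum: "(\<And>a. a \<in> A \<Longrightarrow> f a \<in> poly_values x m) \<Longrightarrow> sum f A \<in> poly_values x m"
  by (induction A rule: infinite_finite_induct) (auto intro: poly_values_zero poly_values_add)

lemma poly_values_mono: "m \<le> m' \<Longrightarrow> poly_values x m \<subseteq> poly_values x m'"
  by (fastforce simp: poly_values_def)

lemma poly_values_mult_var:
  assumes "a \<in> poly_values x m" "k \<in> {1..m}"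
  shows "a * x k \<in> poly_values x m"
proof -
  obtain p where p: "a = poly_eval p x" "poly_vars p \<subseteq> {1..m}"
    using assms(1) by (auto simp: poly_values_def)
  let ?t = "Poly_Mapping.single k (1::nat)"
  have "of_nat (Poly_Mapping.lookup p s) * monomial_eval x s * x k \<in> poly_values x m"
    if s: "s \<in> Poly_Mapping.keys p" for s
  proof -
    have "Poly_Mapping.keys (s + ?t) \<subseteq> {1..m}"
      using Poly_Mapping.keys_add[of s ?t] p(2) assms(2) s by (fastforce simp: poly_vars_def)
    then show ?thesis
      unfolding poly_values_def
      by (intro CollectI exI[of _ "Poly_Mapping.single (s + ?t) (Poly_Mapping.lookup p s)"])
        (simp add: poly_eval_single monomial_eval_add monomial_eval_superset[of "{k}"]
          poly_vars_def mult.assoc)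
  qed
  then show ?thesis
    unfolding p(1) poly_eval_superset[OF finite_keys order_refl] sum_distrib_right
    by (rule poly_values_sum)
qed

section \<open>The triangular expansion\<close>

abbreviation same_shape_below :: "int list \<Rightarrow> int list set" where
  "same_shape_below \<alpha> \<equiv> {\<beta>. one_factor \<beta> \<and> shape \<beta> = shape \<alpha> \<and> \<beta> \<preceq> \<alpha>}"

lemma shape_eq_iff:
  "length \<alpha> = length \<beta> \<Longrightarrow> shape \<alpha> = shape \<beta> \<longleftrightarrow> count_list \<alpha> (-1) = count_list \<beta> (-1)"
  by (auto simp: shape_def Let_def)

text \<open>The total of a 1-factor depends on its shape only, so all 1-factors of one shape have the same
  number of defects.\<close>

lemma sum_list_one_factor:
  assumes "one_factor \<alpha>"
  shows "sum_list \<alpha> = int (length \<alpha>) - 2 * int (count_list \<alpha> (-1))"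
proof -
  have "set \<alpha> \<subseteq> {1, -1}" using assms by (simp add: one_factor_def)
  then show ?thesis by (induction \<alpha>) auto
qed

text \<open>Different indices \<open>a\<close> may produce the same vector \<open>e (h a)\<close>, whose coefficients then have to be added
  up. A vector produced by only one index keeps its coefficient.\<close>

lemma collect_expansion:
  fixes d :: "'b \<Rightarrow> 'a::field"
  assumes A: "finite A" and T: "finite T" and h: "h ` A \<subseteq> T"
    and d: "\<And>a. a \<in> A \<Longrightarrow> d a \<in> poly_values x m"
  obtains c where "(\<Sum>a\<in>A. scale (d a) (e (h a))) = (\<Sum>t\<in>T. scale (c t) (e t))"
    and "\<And>t. c t \<in> poly_values x m"
    and "\<And>a. a \<in> A \<Longrightarrow> (\<And>b. b \<in> A \<Longrightarrow> h b = h a \<Longrightarrow> b = a) \<Longrightarrow> c (h a) = d a"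
proof
  define c where "c t = (\<Sum>a | a \<in> A \<and> h a = t. d a)" for t
  have "(\<Sum>a\<in>A. scale (d a) (e (h a))) = (\<Sum>t\<in>T. \<Sum>a | a \<in> A \<and> h a = t. scale (d a) (e (h a)))"
    by (subst sum.group[OF A T h, symmetric]) simp
  also have "\<dots> = (\<Sum>t\<in>T. scale (c t) (e t))"
    unfolding c_def scale_sum_left by (intro sum.cong) auto
  finally show "(\<Sum>a\<in>A. scale (d a) (e (h a))) = (\<Sum>t\<in>T. scale (c t) (e t))" .
  show "c t \<in> poly_values x m" for t
    unfolding c_def using d by (intro poly_values_sum) auto
  show "c (h a) = d a" if "a \<in> A" "\<And>b. b \<in> A \<Longrightarrow> h b = h a \<Longrightarrow> b = a" for a
  proof -
    have "{b \<in> A. h b = h a} = {a}" using that by auto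
    then show ?thesis by (simp add: c_def)
  qed
qed

lemma mu_snoc: "mu v (\<alpha> @ [a]) = (if a = 1 then Phi1 (mu v \<alpha>) else Phi2 v (mu v \<alpha>))"
  by (simp add: mu_def)

lemma weight_seq_snoc: "weight_seq (\<alpha> @ [a]) = weight_seq \<alpha> @ [sum_list \<alpha> + a]"
  by (auto simp: weight_seq_def)

lemma max_weight_snoc: "max_weight \<alpha> \<le> max_weight (\<alpha> @ [a])"
  unfolding max_weight_def weight_seq_snoc by (intro nat_mono Max_mono) auto

lemma sum_list_le_max_weight: "nat (sum_list \<alpha>) \<le> max_weight \<alpha>"
proof (cases \<alpha> rule: rev_cases)
  case (snoc \<alpha>' a)
  then have "sum_list \<alpha> \<in> insert 0 (set (weight_seq \<alpha>))"
    by (simp add: weight_seq_snoc)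
  then show ?thesis unfolding max_weight_def by (intro nat_mono Max_ge) auto
qed simp

lemma qint_nonzero: "qfact v n \<noteq> 0 \<Longrightarrow> k \<in> {1..n} \<Longrightarrow> qint v (int k) \<noteq> 0"
  by (simp add: qfact_def)

text \<open>Induction along \<open>\<alpha>\<close>. The coefficient of \<open>\<alpha>\<close> itself is tracked separately: the 1-factor \<open>\<alpha> @ [a]\<close> arises
  from exactly one term, namely from \<open>\<alpha>\<close> by appending \<open>a\<close>, so its coefficient is multiplied by 1 or by a
  quantum integer \<open>[i]\<close> with \<open>1 \<le> i \<le> n\<close>.\<close>

lemma mu_expansion:
  fixes v :: "'a::field"
  assumes v: "v \<noteq> 0" and "qfact v n \<noteq> 0" and "one_factor \<alpha>" and "length \<alpha> \<le> n"
  shows "\<exists>c. mu v \<alpha> = (\<Sum>\<beta>\<in>same_shape_below \<alpha>. scale (c \<beta>) (eta v \<beta>)) \<and> c \<alpha> \<noteq> 0 \<and>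
    (\<forall>\<beta>. c \<beta> \<in> poly_values (\<lambda>i. qint v (int i)) (max_weight \<alpha>))"
  using assms(3,4)
proof (induction \<alpha> rule: rev_induct)
  case Nil
  have "same_shape_below [] = {[]}"
    by (auto simp: factor_le_def one_factor_Nil)
  then show ?case
    by (intro exI[of _ "\<lambda>_. 1"]) (simp add: mu_def poly_values_one)
next
  case (snoc a \<alpha>)
  let ?x = "\<lambda>i. qint v (int i)" and ?m = "max_weight (\<alpha> @ [a])"
  let ?S = "same_shape_below \<alpha>" and ?T = "same_shape_below (\<alpha> @ [a])"
  have \<alpha>: "one_factor \<alpha>" and a: "a \<in> {1, -1}" and pos: "0 \<le> sum_list \<alpha> + a"
    using snoc.prems by (auto simp: one_factor_snoc)
  with snoc obtain c where mu: "mu v \<alpha> = (\<Sum>\<beta>\<in>?S. scale (c \<beta>) (eta v \<beta>))" and c0: "c \<alpha> \<noteq> 0"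
    and cv: "\<And>\<beta>. c \<beta> \<in> poly_values ?x (max_weight \<alpha>)"
    by auto
  have cv': "c \<beta> \<in> poly_values ?x ?m" for \<beta>
    using cv poly_values_mono[OF max_weight_snoc] by blast
  have S: "finite ?S" and T: "finite ?T" by (rule finite_factors_below)+
  have \<alpha>S: "\<alpha> \<in> ?S" using \<alpha> by (simp add: factor_le_refl)
  have len: "length \<beta> = length \<alpha>" if "\<beta> \<in> ?S" for \<beta>
    using that by (simp add: factor_le_def)
  have cnt: "count_list \<beta> (-1) = count_list \<alpha> (-1)" if "\<beta> \<in> ?S" for \<beta>
    using that len[OF that] shape_eq_iff by auto
  have sumS: "sum_list \<beta> = sum_list \<alpha>" if "\<beta> \<in> ?S" for \<beta>
    using that len[OF that] cnt[OF that] \<alpha> by (simp add: sum_list_one_factor)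
  show ?case
  proof (cases "a = 1")
    case True
    have phi: "Phi1 (mu v \<alpha>) = (\<Sum>\<beta>\<in>?S. scale (c \<beta>) (eta v (\<beta> @ [1])))"
      using one_factor_Cons[OF one_factor_Nil]
      by (simp add: mu Phi1_def sum_distrib_right scale_mult_left eta_append eta_singleton
          del: eta.simps)
    have h: "(\<lambda>\<beta>. \<beta> @ [1]) ` ?S \<subseteq> ?T"
    proof clarify
      fix \<beta> assume b: "one_factor \<beta>" "shape \<beta> = shape \<alpha>" "\<beta> \<preceq> \<alpha>"
      then have \<beta>: "\<beta> \<in> ?S" by simp
      have "shape (\<beta> @ [1]) = shape (\<alpha> @ [1])"
        using cnt[OF \<beta>] len[OF \<beta>] by (subst shape_eq_iff) auto
      then show "one_factor (\<beta> @ [1]) \<and> shape (\<beta> @ [1]) = shape (\<alpha> @ [a]) \<and> \<beta> @ [1] \<preceq> \<alpha> @ [a]"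
        using b True one_factor_sum_nonneg[OF b(1)] factor_le_append[OF b(3) factor_le_refl]
        by (simp add: one_factor_snoc)
    qed
    obtain c' where c':
      "(\<Sum>\<beta>\<in>?S. scale (c \<beta>) (eta v (\<beta> @ [1]))) = (\<Sum>\<beta>\<in>?T. scale (c' \<beta>) (eta v \<beta>))"
      "\<And>\<beta>. c' \<beta> \<in> poly_values ?x ?m"
      "\<And>\<beta>. \<beta> \<in> ?S \<Longrightarrow> (\<And>\<gamma>. \<gamma> \<in> ?S \<Longrightarrow> \<gamma> @ [1] = \<beta> @ [1] \<Longrightarrow> \<gamma> = \<beta>) \<Longrightarrow> c' (\<beta> @ [1]) = c \<beta>"
      using collect_expansion[OF S T h, of c ?x ?m "eta v"] cv' by blast
    have "c' (\<alpha> @ [1]) = c \<alpha>" using \<alpha>S by (intro c'(3)) auto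
    then show ?thesis using c0 True phi c'(1,2) by (intro exI[of _ c']) (simp add: mu_snoc)
  next
    case False
    then have a: "a = -1" using a by simp
    define i where "i = nat (sum_list \<alpha>)"
    have i: "sum_list \<alpha> = int i" "1 \<le> i" using pos a by (auto simp: i_def)
    have im: "i \<le> ?m"
      using sum_list_le_max_weight[of \<alpha>] max_weight_snoc[of \<alpha> a] by (simp add: i_def)
    have "i \<le> n" using sum_list_one_factor[OF \<alpha>] snoc.prems i by simp
    then have qi: "qint v (int i) \<noteq> 0" using qint_nonzero[OF assms(2)] i by simp
    have "\<forall>\<beta>\<in>?S. \<exists>g. Phi2_terms v \<beta> i g"
      using Phi2_eta_expansion[OF v] sumS i(1) by simp
    then obtain G where terms: "\<forall>\<beta>\<in>?S. Phi2_terms v \<beta> i (G \<beta>)"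
      by (rule bchoice[THEN exE])
    have G_sum: "Phi2 v (eta v \<beta>) = (\<Sum>k=1..i. scale (qint v (int k)) (eta v (G \<beta> k)))"
      and G_last: "\<And>k. k \<in> {1..<i} \<Longrightarrow> last (G \<beta> k) = 1" and G_i: "G \<beta> i = \<beta> @ [-1]"
      if "\<beta> \<in> ?S" for \<beta>
      using bspec[OF terms that] i(2) by (simp_all add: Phi2_terms_def)
    have G: "one_factor (G \<beta> k) \<and> G \<beta> k \<preceq> \<beta> @ [-1] \<and>
        count_list (G \<beta> k) (-1) = Suc (count_list \<beta> (-1))" if "\<beta> \<in> ?S" "k \<in> {1..i}" for \<beta> k
      using bspec[OF terms that(1)] that(2) by (simp add: Phi2_terms_def)
    let ?A = "?S \<times> {1..i}" and ?h = "\<lambda>(\<beta>, k). G \<beta> k" and ?d = "\<lambda>(\<beta>, k). c \<beta> * qint v (int k)"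
    have "Phi2 v (mu v \<alpha>) = (\<Sum>\<beta>\<in>?S. scale (c \<beta>) (Phi2 v (eta v \<beta>)))"
      unfolding mu Phi2_def by (simp only: lin_ext_sum lin_ext_scale)
    also have "\<dots> = (\<Sum>p\<in>?A. scale (?d p) (eta v (?h p)))"
      by (simp add: G_sum scale_sum_right scale_scale sum.cartesian_product case_prod_unfold)
    finally have phi: "Phi2 v (mu v \<alpha>) = \<dots>" .
    have h: "?h ` ?A \<subseteq> ?T"
    proof clarify
      fix \<beta> k assume b: "one_factor \<beta>" "shape \<beta> = shape \<alpha>" "\<beta> \<preceq> \<alpha>" and k: "k \<in> {1..i}"
      then have \<beta>: "\<beta> \<in> ?S" by simp
      note Gk = G[OF \<beta> k]
      have "G \<beta> k \<preceq> \<alpha> @ [-1]"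
        using Gk factor_le_append[OF b(3) factor_le_refl] factor_le_trans by blast
      moreover from this have "shape (G \<beta> k) = shape (\<alpha> @ [-1])"
        using Gk cnt[OF \<beta>] by (subst shape_eq_iff) (auto simp: factor_le_def)
      ultimately show "one_factor (G \<beta> k) \<and> shape (G \<beta> k) = shape (\<alpha> @ [a]) \<and> G \<beta> k \<preceq> \<alpha> @ [a]"
        using Gk a by simp
    qed
    have d: "?d p \<in> poly_values ?x ?m" if "p \<in> ?A" for p
      using that cv' im by (auto intro!: poly_values_mult_var)
    have uniq: "p = (\<alpha>, i)" if p: "p \<in> ?A" "?h p = ?h (\<alpha>, i)" for p
    proof -
      obtain \<beta> k where pk: "p = (\<beta>, k)" "\<beta> \<in> ?S" "k \<in> {1..i}" using p(1) by auto
      have e: "G \<beta> k = \<alpha> @ [-1]" using p(2) pk G_i[OF \<alpha>S] by simp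
      then have "last (G \<beta> k) \<noteq> 1" by simp
      then have "k = i" using G_last[OF pk(2), of k] pk(3) by fastforce
      with e G_i[OF pk(2)] pk show ?thesis by simp
    qed
    have A: "finite ?A" using S by simp
    obtain c' where c':
      "(\<Sum>p\<in>?A. scale (?d p) (eta v (?h p))) = (\<Sum>\<beta>\<in>?T. scale (c' \<beta>) (eta v \<beta>))"
      "\<And>\<beta>. c' \<beta> \<in> poly_values ?x ?m"
      "\<And>p. p \<in> ?A \<Longrightarrow> (\<And>q. q \<in> ?A \<Longrightarrow> ?h q = ?h p \<Longrightarrow> q = p) \<Longrightarrow> c' (?h p) = ?d p"
      using collect_expansion[OF A T h, of ?d ?x ?m "eta v"] d by blast
    have "c' (?h (\<alpha>, i)) = ?d (\<alpha>, i)"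
      using \<alpha>S i(2) uniq by (intro c'(3)) auto
    then have "c' (\<alpha> @ [a]) \<noteq> 0" using c0 qi G_i[OF \<alpha>S] a by simp
    then show ?thesis using c'(1,2) phi a by (intro exI[of _ c']) (simp add: mu_snoc)
  qed
qed

theorem corollary4p11:
  fixes v :: "'a::field" and n :: nat and \<alpha> :: "int list"
  assumes "v \<noteq> 0"
    and "qfact v n \<noteq> 0"
    and "one_factor \<alpha>"
    and "length \<alpha> \<le> n"
  shows "\<exists>\<pi>' :: int list \<Rightarrow> 'a.
      mu v \<alpha> = (\<Sum>\<beta> | one_factor \<beta> \<and> shape \<beta> = shape \<alpha> \<and> \<beta> \<preceq> \<alpha>. scale (\<pi>' \<beta>) (eta v \<beta>)) \<and>
      \<pi>' \<alpha> \<noteq> 0 \<and>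
      (\<exists>\<pi>'' :: int list \<Rightarrow> nat_mpoly.
        \<forall>\<beta>. one_factor \<beta> \<and> shape \<beta> = shape \<alpha> \<and> \<beta> \<preceq> \<alpha> \<longrightarrow>
          poly_vars (\<pi>'' \<beta>) \<subseteq> {1..max_weight \<alpha>} \<and>
          \<pi>' \<beta> = poly_eval (\<pi>'' \<beta>) (\<lambda>i. qint v (int i)))"
proof -
  obtain c where c: "mu v \<alpha> = (\<Sum>\<beta>\<in>same_shape_below \<alpha>. scale (c \<beta>) (eta v \<beta>))" "c \<alpha> \<noteq> 0"
    and vals: "\<And>\<beta>. c \<beta> \<in> poly_values (\<lambda>i. qint v (int i)) (max_weight \<alpha>)"
    using mu_expansion[OF assms] by blast
  have "\<forall>\<beta>. \<exists>p. poly_vars p \<subseteq> {1..max_weight \<alpha>} \<and> c \<beta> = poly_eval p (\<lambda>i. qint v (int i))"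
    using vals by (auto simp: poly_values_def)
  then obtain P where
    "\<forall>\<beta>. poly_vars (P \<beta>) \<subseteq> {1..max_weight \<alpha>} \<and> c \<beta> = poly_eval (P \<beta>) (\<lambda>i. qint v (int i))"
    by metis
  with c show ?thesis by blast
qed

end
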